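(* Let $p$ be a prime, $n\ge 2$ an integer, $\gamma\in\mathbb{Z}$, and let $\underline{a}=(a_0,a_1,\ldots,a_{n-1},\ldots)$ be a $p$-ary sequence of period $n$. Let $H=\langle h\rangle$ and $P=\langle g\rangle$ be (multiplicatively written) cyclic groups of order $n$ and $p$, respectively, and let $G=H\times P$. Fix a primitive $p$-th root of unity $\zeta_p\in\mathbb{C}$, and for $0\le i\le n-1$ let $b_i\in\{0,1,\ldots,p-1\}$ be the integer such that $a_i=\zeta_p^{b_i}$. Let $$R=\{g^{b_i}h^i\in G : 0\le i\le n-1\}.$$ Then $\underline{a}$ is a $p$-ary nearly perfect sequence of type $\gamma$ if and only if $R$ is an $\left(n,p,n,\frac{n-\gamma}{p}+\gamma,0,\frac{n-\gamma}{p}\right)$-direct product difference set in $G$ relative to $H$ and $P$. In particular, in that case $p$ divides $n-\gamma$.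
   Context: A $p$-ary sequence of period $n$ is a sequence $\underline{a}=(a_0,a_1,\ldots)$ of complex numbers of period $n$ (so $a_{i+n}=a_i$) all of whose entries are of the form $a_i=\zeta_p^{b_i}$ with $b_i$ an integer, where $\zeta_p\in\mathbb{C}$ is a primitive $p$-th root of unity. Its autocorrelation function is $C_{\underline{a}}(t)=\sum_{i=0}^{n-1}a_i\overline{a_{i+t}}$ for $0\le t\le n-1$. The sequence is a nearly perfect sequence (NPS) of type $\gamma$ if $C_{\underline{a}}(t)=\gamma$ for all $1\le t\le n-1$. Let $G=H\times N$ be a group with $|H|=m$ and $|N|=n'$ ($H$ and $N$ are regarded as subgroups of $G$). A subset $R\subseteq G$ is an $(m,n',k,\lambda_1,\lambda_2,\mu)$-direct product difference set (DPDS) in $G$ relative to $H$ and $N$ if $|R|=k$ and the differences $r_1r_2^{-1}$, with $r_1,r_2\in R$, $r_1\ne r_2$, represent every non-identity element of $H$ exactly $\lambda_1$ times, every non-identity element of $N$ exactly $\lambda_2$ times, and every element of $G\setminus(H\cup N)$ exactly $\mu$ times. *)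

theory Defs
  imports Complex_Main "HOL-Algebra.Generated_Groups" "HOL-Computational_Algebra.Primes"
begin

definition primitive_root_of_unity :: "nat \<Rightarrow> complex \<Rightarrow> bool" where
  "primitive_root_of_unity p z \<longleftrightarrow> 0 < p \<and> z ^ p = 1 \<and> (\<forall>k. 0 < k \<and> k < p \<longrightarrow> z ^ k \<noteq> 1)"

definition p_ary_sequence :: "nat \<Rightarrow> nat \<Rightarrow> (nat \<Rightarrow> complex) \<Rightarrow> bool" where
  "p_ary_sequence p n a \<longleftrightarrow>
     (\<forall>i. a (i + n) = a i) \<and>
     (\<exists>z. primitive_root_of_unity p z \<and> (\<forall>i. \<exists>b::int. a i = z powi b))"

definition autocorrelation :: "nat \<Rightarrow> (nat \<Rightarrow> complex) \<Rightarrow> nat \<Rightarrow> complex" where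
  "autocorrelation n a t = (\<Sum>i<n. a i * cnj (a (i + t)))"

definition nearly_perfect_sequence :: "nat \<Rightarrow> nat \<Rightarrow> complex \<Rightarrow> (nat \<Rightarrow> complex) \<Rightarrow> bool" where
  "nearly_perfect_sequence p n \<gamma> a \<longleftrightarrow>
     p_ary_sequence p n a \<and> (\<forall>t\<in>{1..n - 1}. autocorrelation n a t = \<gamma>)"

definition difference_count :: "('a, 'c) monoid_scheme \<Rightarrow> 'a set \<Rightarrow> 'a \<Rightarrow> nat" where
  "difference_count G R x =
     card {(r1, r2). r1 \<in> R \<and> r2 \<in> R \<and> r1 \<noteq> r2 \<and> r1 \<otimes>\<^bsub>G\<^esub> inv\<^bsub>G\<^esub> r2 = x}"

(* The factors H and N as subgroups of H \<times>\<times> N. *)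
definition left_factor :: "('a, 'c) monoid_scheme \<Rightarrow> ('b, 'd) monoid_scheme \<Rightarrow> ('a \<times> 'b) set" where
  "left_factor H N = carrier H \<times> {\<one>\<^bsub>N\<^esub>}"

definition right_factor :: "('a, 'c) monoid_scheme \<Rightarrow> ('b, 'd) monoid_scheme \<Rightarrow> ('a \<times> 'b) set" where
  "right_factor H N = {\<one>\<^bsub>H\<^esub>} \<times> carrier N"

(* The multiplicities l1, l2, mu are real, so that a parameter given by a quotient
   can be inserted as it is: a parameter that is not a natural number is simply not attained
   by a nonempty class of elements.  Finiteness is explicit because the order of an infinite
   group and the cardinality of an infinite set are 0. *)
definition direct_product_difference_set ::
  "('a, 'c) monoid_scheme \<Rightarrow> ('b, 'd) monoid_scheme \<Rightarrow> nat \<Rightarrow> nat \<Rightarrow> nat \<Rightarrow> real \<Rightarrow> real \<Rightarrow> real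
     \<Rightarrow> ('a \<times> 'b) set \<Rightarrow> bool" where
  "direct_product_difference_set H N m n' k l1 l2 mu R \<longleftrightarrow>
     group H \<and> group N \<and> finite (carrier H) \<and> finite (carrier N) \<and>
     order H = m \<and> order N = n' \<and>
     R \<subseteq> carrier (H \<times>\<times> N) \<and> card R = k \<and>
     (\<forall>x \<in> left_factor H N - {\<one>\<^bsub>H \<times>\<times> N\<^esub>}. real (difference_count (H \<times>\<times> N) R x) = l1) \<and>
     (\<forall>x \<in> right_factor H N - {\<one>\<^bsub>H \<times>\<times> N\<^esub>}. real (difference_count (H \<times>\<times> N) R x) = l2) \<and>
     (\<forall>x \<in> carrier (H \<times>\<times> N) - (left_factor H N \<union> right_factor H N).
        real (difference_count (H \<times>\<times> N) R x) = mu)"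

end

theory Submission
  imports "HOL-Computational_Algebra.Polynomial_Factorial" "HOL-Algebra.Multiplicative_Group" Defs
begin

text \<open>
  Let \<open>D t u\<close> be the number of positions \<open>i\<close> in one period at which
  \<open>b i - b (i + t)\<close> is congruent to \<open>u\<close> modulo \<open>p\<close>. Both sides of the equivalence are
  conditions on these numbers.

  On the analytic side, \<open>a i\<close> times the conjugate of \<open>a (i + t)\<close> is \<open>\<zeta>\<close> to the power
  \<open>b i - b (i + t)\<close>, so collecting equal powers turns the autocorrelation at \<open>t\<close> into the sum
  of \<open>D t u * \<zeta> ^ u\<close> over \<open>u < p\<close> (\<open>autocorrelation_eq_sum_shift_count\<close>).
  Since \<open>p\<close> is prime, the only integer relations between \<open>1, \<zeta>, \<dots>, \<zeta> ^ (p - 1)\<close> are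
  the multiples of the vanishing of their sum (\<open>integer_relation_primitive_root\<close>). Hence the
  autocorrelation equals \<open>\<gamma>\<close> exactly when \<open>D t 0 - \<gamma>\<close> and all \<open>D t u\<close> with \<open>u > 0\<close> have
  one common value. The \<open>D t u\<close> add up to \<open>n\<close>, so this value is \<open>(n - \<gamma>) / p\<close>
  (\<open>weighted_root_sum_eq_int_iff\<close>); being a count it is an integer, which gives the
  divisibility.

  On the group side, a pair of distinct elements of \<open>R\<close> is a pair of distinct positions, and the
  difference of the elements at positions \<open>i\<close> and \<open>i + t\<close> is the pair of \<open>h\<close> to the power \<open>- t\<close> and \<open>g\<close> to
  the power \<open>b i - b (i + t)\<close>. So \<open>D t u\<close> is the multiplicity of a group element outside the
  second factor (\<open>difference_count_eq_shift_count\<close>), with \<open>u = 0\<close> for elements of the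
  first factor, while the non-identity elements of the second factor are never differences because
  \<open>R\<close> has one element above each power of \<open>h\<close>.

  The arithmetic input is that \<open>\<zeta> - 1\<close> is a root of an Eisenstein polynomial of degree
  \<open>p - 1\<close>, so that by Gauss's lemma no nonzero integer polynomial of smaller degree vanishes
  at \<open>\<zeta>\<close>.
\<close>

section \<open>Integer relations between powers of a root of unity\<close>

text \<open>
  The argument behind Eisenstein's criterion. The lowest coefficient of \<open>G\<close> that \<open>p\<close> does not
  divide, at index \<open>k\<close> say, makes the coefficient of \<open>E\<close> at \<open>k\<close> congruent to its product with the
  constant term of \<open>K\<close>, hence not divisible by \<open>p\<close>. So \<open>k\<close> cannot lie below the
  degree of \<open>E\<close>, and \<open>G\<close> already has full degree.
\<close>

lemma eisenstein_degree_factor: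
  fixes E G K :: "int poly"
  assumes p: "prime p" and E: "E = G * K"
    and low: "\<And>k. k < degree E \<Longrightarrow> p dvd poly.coeff E k"
    and lead: "\<not> p dvd lead_coeff E"
    and G0: "p dvd poly.coeff G 0" and K0: "\<not> p dvd poly.coeff K 0"
  shows "degree K = 0"
proof -
  have lcG: "\<not> p dvd lead_coeff G"
    using lead by (auto simp: E lead_coeff_mult)
  define k where "k = (LEAST k. \<not> p dvd poly.coeff G k)"
  have k: "\<not> p dvd poly.coeff G k"
    unfolding k_def by (rule LeastI[of _ "degree G"]) (rule lcG)
  have less_k: "p dvd poly.coeff G i" if "i < k" for i
    using not_less_Least that unfolding k_def by blast
  have "k \<le> degree G"
    unfolding k_def by (rule Least_le) (rule lcG)
  have "poly.coeff E k = (\<Sum>i\<le>k. poly.coeff G i * poly.coeff K (k - i))"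
    by (simp add: E coeff_mult)
  also have "\<dots> = poly.coeff G k * poly.coeff K 0 + (\<Sum>i<k. poly.coeff G i * poly.coeff K (k - i))"
    by (simp add: lessThan_Suc_atMost[symmetric])
  finally have "poly.coeff E k = \<dots>" .
  moreover have "p dvd (\<Sum>i<k. poly.coeff G i * poly.coeff K (k - i))"
    by (intro dvd_sum dvd_mult2 less_k) simp
  moreover have "\<not> p dvd poly.coeff G k * poly.coeff K 0"
    using p k K0 by (simp add: prime_dvd_mult_iff)
  ultimately have "\<not> p dvd poly.coeff E k"
    by (simp add: dvd_add_left_iff)
  hence "degree E \<le> k"
    using low not_less by blast
  moreover have "degree E = degree G + degree K"
    using lead by (auto simp: E intro!: degree_mult_eq)
  ultimately show ?thesis
    using \<open>k \<le> degree G\<close> by simp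
qed

text \<open>
  As \<open>p\<close> divides the constant term of \<open>E\<close> exactly once, it divides the constant term of exactly
  one factor, so the other factor is constant; over the integers it is moreover a unit
  because \<open>E\<close> is monic.
\<close>

lemma eisenstein_irreducible:
  fixes E :: "int poly"
  assumes p: "prime p" and deg: "degree E > 0" and monic: "lead_coeff E = 1"
    and low: "\<And>k. k < degree E \<Longrightarrow> p dvd poly.coeff E k"
    and p2: "\<not> p\<^sup>2 dvd poly.coeff E 0"
  shows "Factorial_Ring.irreducible E"
proof (rule Factorial_Ring.irreducibleI)
  show "E \<noteq> 0" using deg by auto
  show "\<not> E dvd 1" using deg by (auto elim!: is_unit_polyE)
  fix G K assume E: "E = G * K"
  have lead: "\<not> p dvd lead_coeff E"
    using p monic by (auto dest: not_prime_unit)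
  have E0: "poly.coeff E 0 = poly.coeff G 0 * poly.coeff K 0"
    by (simp add: E coeff_mult)
  have "degree G = 0 \<or> degree K = 0"
  proof (cases "p dvd poly.coeff G 0")
    case True
    hence "\<not> p dvd poly.coeff K 0"
      using p2 unfolding E0 power2_eq_square by (metis mult_dvd_mono)
    hence "degree K = 0"
      using eisenstein_degree_factor[OF p E low lead True] by simp
    thus ?thesis ..
  next
    case False
    moreover have "p dvd poly.coeff K 0"
      using low[of 0] deg p False by (auto simp: E0 prime_dvd_mult_iff)
    moreover have KG: "E = K * G" by (simp add: E mult.commute)
    ultimately have "degree G = 0"
      using eisenstein_degree_factor[OF p KG low lead] by simp
    thus ?thesis ..
  qed
  moreover have unit: "A dvd 1" if "degree A = 0" "lead_coeff A dvd 1" for A :: "int poly"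
    using that by (elim degree_eq_zeroE) (auto simp: is_unit_const_poly_iff)
  moreover have "lead_coeff G * lead_coeff K = 1"
    using monic by (simp add: E lead_coeff_mult)
  hence "lead_coeff G dvd 1" "lead_coeff K dvd 1"
    by (metis dvd_triv_left, metis dvd_triv_right)
  ultimately show "G dvd 1 \<or> K dvd 1" by blast
qed

lemma map_poly_of_int_add:
  "map_poly of_int (f + g) = (map_poly of_int f + map_poly of_int g :: 'a::comm_ring_1 poly)"
  by (intro poly_eqI) (simp add: coeff_map_poly)

lemma map_poly_of_int_mult:
  "map_poly of_int (f * g) = (map_poly of_int f * map_poly of_int g :: 'a::comm_ring_1 poly)"
  by (intro poly_eqI) (simp add: coeff_map_poly coeff_mult)

text \<open>
  An integer polynomial \<open>m\<close> of least degree with root \<open>z\<close> divides a constant multiple of \<open>E\<close>, by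
  pseudo-division and minimality. Gauss's lemma enters through the fact that integer polynomials form
  a factorial ring: \<open>E\<close> is prime there and does not divide \<open>m\<close>, so it divides the cofactor, and
  cancelling it leaves \<open>m\<close> constant.
\<close>

lemma irreducible_poly_minimal_degree:
  fixes E f :: "int poly" and z :: "'a::{idom, ring_char_0}"
  assumes irr: "Factorial_Ring.irreducible E" and Ez: "poly (map_poly of_int E) z = 0"
    and fz: "poly (map_poly of_int f) z = 0" and deg: "degree f < degree E"
  shows "f = 0"
proof (rule ccontr)
  assume "f \<noteq> 0"
  define Q where "Q g \<longleftrightarrow> g \<noteq> 0 \<and> poly (map_poly of_int g) z = 0" for g :: "int poly"
  have "Q f" using \<open>f \<noteq> 0\<close> fz by (simp add: Q_def)
  then obtain m where m: "Q m" and least: "\<And>g. Q g \<Longrightarrow> degree m \<le> degree g"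
    using ex_has_least_nat[of Q f degree] by blast
  have m0: "m \<noteq> 0" and mz: "poly (map_poly of_int m) z = 0"
    using m by (auto simp: Q_def)
  obtain c q where c: "c \<noteq> 0" and cq: "Polynomial.smult c E = m * q + pseudo_mod E m"
    using pseudo_mod(1)[OF m0] by blast
  have "poly (map_poly of_int (pseudo_mod E m)) z = 0"
    using arg_cong[OF cq, of "\<lambda>g. poly (map_poly of_int g) z"] Ez mz
    by (simp add: map_poly_of_int_add map_poly_of_int_mult map_poly_smult)
  hence "pseudo_mod E m = 0"
    using pseudo_mod(2)[OF m0, of E] least[of "pseudo_mod E m"] by (metis Q_def not_less)
  with cq have cE: "Polynomial.smult c E = m * q" by simp
  have "prime_elem E"
    using irr by (rule irreducible_imp_prime_elem)
  moreover have "E dvd m * q"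
    by (simp add: dvd_smult flip: cE)
  moreover have "\<not> E dvd m"
    using dvd_imp_degree_le[OF _ m0] least[OF \<open>Q f\<close>] deg by fastforce
  ultimately have "E dvd q"
    by (simp add: prime_elem_dvd_mult_iff)
  then obtain s where "q = E * s" ..
  hence "E * [:c:] = E * (m * s)"
    using cE by (simp add: mult_ac)
  moreover have "E \<noteq> 0" using deg by auto
  ultimately have "[:c:] = m * s" by (metis mult_left_cancel)
  moreover from this have "s \<noteq> 0" using c by auto
  ultimately have "degree m = 0"
    using m0 by (metis add_eq_0_iff_both_eq_0 degree_mult_eq degree_pCons_0)
  then obtain d where "m = [:d:]" by (elim degree_eq_zeroE)
  thus False using m0 mz by (simp add: map_poly_pCons)
qed

text \<open>
  For prime \<open>p\<close> this is the \<open>p\<close>-th cyclotomic polynomial evaluated at \<open>X + 1\<close>, that is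
  \<open>((X + 1) ^ p - 1) / X\<close>, the form to which Eisenstein's criterion applies.
\<close>

definition shifted_cyclotomic :: "nat \<Rightarrow> int poly" where
  "shifted_cyclotomic p = (\<Sum>k<p. Polynomial.monom (int (p choose Suc k)) k)"

lemma coeff_shifted_cyclotomic: "poly.coeff (shifted_cyclotomic p) k = int (p choose Suc k)"
proof -
  have "poly.coeff (shifted_cyclotomic p) k = (\<Sum>j<p. if j = k then int (p choose Suc j) else 0)"
    by (simp add: shifted_cyclotomic_def coeff_sum)
  also have "\<dots> = int (p choose Suc k)"
    by (subst sum.delta) (auto simp: binomial_eq_0)
  finally show ?thesis .
qed

lemma degree_shifted_cyclotomic: "p > 0 \<Longrightarrow> degree (shifted_cyclotomic p) = p - 1"
proof (rule antisym)
  show "degree (shifted_cyclotomic p) \<le> p - 1"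
    by (rule degree_le) (auto simp: coeff_shifted_cyclotomic)
  assume "p > 0"
  thus "p - 1 \<le> degree (shifted_cyclotomic p)"
    by (intro le_degree) (simp add: coeff_shifted_cyclotomic)
qed

lemma irreducible_shifted_cyclotomic:
  assumes "prime p"
  shows "Factorial_Ring.irreducible (shifted_cyclotomic p)"
proof (rule eisenstein_irreducible)
  have p: "p \<ge> 2" using assms by (rule prime_ge_2_nat)
  note deg = degree_shifted_cyclotomic[of p]
  show "prime (int p)" using assms by simp
  show "degree (shifted_cyclotomic p) > 0" using deg p by simp
  show "lead_coeff (shifted_cyclotomic p) = 1"
    using deg p by (simp add: coeff_shifted_cyclotomic)
  show "int p dvd poly.coeff (shifted_cyclotomic p) k" if "k < degree (shifted_cyclotomic p)" for k
    using that deg p assms by (auto simp: coeff_shifted_cyclotomic intro!: dvd_choose_prime)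
  show "\<not> (int p)\<^sup>2 dvd poly.coeff (shifted_cyclotomic p) 0"
  proof
    assume "(int p)\<^sup>2 dvd poly.coeff (shifted_cyclotomic p) 0"
    hence "int (p * p) dvd int p"
      by (simp add: coeff_shifted_cyclotomic power2_eq_square)
    hence "p * p \<le> p" using p by (metis dvd_imp_le int_dvd_int_iff less_le_trans zero_less_numeral)
    thus False using p by simp
  qed
qed

lemma poly_shifted_cyclotomic:
  fixes z :: "'a::{idom, ring_char_0}"
  assumes "z ^ p = 1" and "z \<noteq> 1"
  shows "poly (map_poly of_int (shifted_cyclotomic p)) (z - 1) = 0"
proof -
  have "map_poly of_int (shifted_cyclotomic p)
      = (\<Sum>k<p. Polynomial.monom (of_nat (p choose Suc k) :: 'a) k)"
    by (intro poly_eqI) (simp add: coeff_map_poly shifted_cyclotomic_def coeff_sum if_distrib cong: if_cong)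
  hence "(z - 1) * poly (map_poly of_int (shifted_cyclotomic p)) (z - 1)
      = (\<Sum>k<p. of_nat (p choose Suc k) * (z - 1) ^ Suc k)"
    by (simp add: poly_sum poly_monom sum_distrib_left mult_ac)
  also have "\<dots> = (\<Sum>k\<le>p. of_nat (p choose k) * (z - 1) ^ k) - 1"
    by (simp add: lessThan_Suc_atMost[symmetric] sum.lessThan_Suc_shift del: sum.lessThan_Suc)
  also have "\<dots> = ((z - 1) + 1) ^ p - 1"
    by (subst binomial_ring) simp
  also have "\<dots> = 0" using assms(1) by simp
  finally show ?thesis using assms(2) by simp
qed

lemma primitive_root_ne_1:
  "primitive_root_of_unity p \<zeta> \<Longrightarrow> p > 1 \<Longrightarrow> \<zeta> \<noteq> 1"
  unfolding primitive_root_of_unity_def by (metis power_one zero_less_one)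

lemma sum_powers_primitive_root:
  assumes "primitive_root_of_unity p \<zeta>" and "p > 1"
  shows "(\<Sum>u<p. \<zeta> ^ u) = 0"
  using geometric_sum[OF primitive_root_ne_1[OF assms], of p] assms
  by (simp add: primitive_root_of_unity_def)

text \<open>
  Given a relation, subtracting \<open>c (p - 1)\<close> from every coefficient does not change the sum, because the powers of
  \<open>\<zeta>\<close> add up to zero. It leaves an integer polynomial of degree at most \<open>p - 2\<close>
  with root \<open>\<zeta>\<close>, which must vanish.
\<close>

lemma integer_relation_primitive_root:
  fixes c :: "nat \<Rightarrow> int"
  assumes p: "prime p" and \<zeta>: "primitive_root_of_unity p \<zeta>"
  shows "(\<Sum>u<p. of_int (c u) * \<zeta> ^ u) = 0 \<longleftrightarrow> (\<forall>u<p. c u = c 0)"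
proof
  have p1: "p > 1" using p by (rule prime_gt_1_nat)
  {
    assume const: "\<forall>u<p. c u = c 0"
    have "(\<Sum>u<p. of_int (c u) * \<zeta> ^ u) = (\<Sum>u<p. of_int (c 0) * \<zeta> ^ u)"
      using const by (intro sum.cong refl) (metis lessThan_iff)
    also have "\<dots> = of_int (c 0) * (\<Sum>u<p. \<zeta> ^ u)"
      by (simp add: sum_distrib_left)
    finally have "(\<Sum>u<p. of_int (c u) * \<zeta> ^ u) = of_int (c 0) * (\<Sum>u<p. \<zeta> ^ u)" .
    thus "(\<Sum>u<p. of_int (c u) * \<zeta> ^ u) = 0"
      by (simp add: sum_powers_primitive_root[OF \<zeta> p1])
  }
  assume rel: "(\<Sum>u<p. of_int (c u) * \<zeta> ^ u) = 0"
  define d where "d u = c u - c (p - 1)" for u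
  define f where "f = (\<Sum>u<p. Polynomial.monom (d u) u)"
  have coeff_f: "poly.coeff f k = (if k < p then d k else 0)" for k
    by (simp add: f_def coeff_sum)
  have "degree f \<le> p - 2"
    proof (rule degree_le, intro allI impI)
    fix i assume "p - 2 < i"
    hence "i = p - 1 \<or> i \<ge> p" by linarith
    thus "poly.coeff f i = 0" by (auto simp: coeff_f d_def)
  qed
  \<comment> \<open>The irreducible polynomial has the root \<open>\<zeta> - 1\<close>, so \<open>f\<close> is shifted in the same way.\<close>
  define F where "F = pcompose f [:1, 1:]"
  have "poly (map_poly of_int f) \<zeta> = (\<Sum>u<p. of_int (d u) * \<zeta> ^ u)"
  proof -
    have "map_poly of_int f = (\<Sum>u<p. Polynomial.monom (of_int (d u) :: complex) u)"
      by (intro poly_eqI) (simp add: coeff_map_poly coeff_f coeff_sum)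
    thus ?thesis by (simp add: poly_sum poly_monom)
  qed
  also have "\<dots> = (\<Sum>u<p. of_int (c u) * \<zeta> ^ u) - of_int (c (p - 1)) * (\<Sum>u<p. \<zeta> ^ u)"
    by (simp add: d_def left_diff_distrib sum_subtractf sum_distrib_left)
  also have "\<dots> = 0"
    using rel sum_powers_primitive_root[OF \<zeta> p1] by simp
  finally have f0: "poly (map_poly of_int f) \<zeta> = 0" .
  have "map_poly of_int (pcompose g [:1, 1:]) = (pcompose (map_poly of_int g) [:1, 1:] :: complex poly)" for g
    by (induction g) (simp_all add: pcompose_pCons map_poly_of_int_add map_poly_of_int_mult map_poly_pCons)
  hence "poly (map_poly of_int F) (\<zeta> - 1) = 0"
    using f0 by (simp add: F_def poly_pcompose)
  moreover have "degree F < degree (shifted_cyclotomic p)"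
    using \<open>degree f \<le> p - 2\<close> p1 by (simp add: F_def degree_pcompose degree_shifted_cyclotomic)
  moreover have "poly (map_poly of_int (shifted_cyclotomic p)) (\<zeta> - 1) = 0"
    using \<zeta> primitive_root_ne_1[OF \<zeta> p1]
    by (intro poly_shifted_cyclotomic) (auto simp: primitive_root_of_unity_def)
  ultimately have "F = 0"
    using irreducible_poly_minimal_degree irreducible_shifted_cyclotomic[OF p] by blast
  hence "f = 0" by (simp add: F_def pcompose_eq_0_iff)
  hence d0: "d u = 0" if "u < p" for u
    using coeff_f[of u] that by simp
  hence "c u = c (p - 1)" if "u < p" for u
    using d0[OF that] by (simp add: d_def)
  thus "\<forall>u<p. c u = c 0" using p1 by (metis less_trans zero_less_one)
qed

text \<open>
  Moving \<open>\<gamma>\<close> into the coefficient of \<open>\<zeta> ^ 0\<close> gives an integer relation whose coefficients add up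
  to \<open>n - \<gamma>\<close>. They are all equal precisely when each of them is the mean
  \<open>(n - \<gamma>) / p\<close>.
\<close>

lemma weighted_root_sum_eq_int_iff:
  fixes D :: "nat \<Rightarrow> nat" and \<gamma> :: int
  assumes p: "prime p" and \<zeta>: "primitive_root_of_unity p \<zeta>" and n: "(\<Sum>u<p. D u) = n"
  shows "(\<Sum>u<p. of_nat (D u) * \<zeta> ^ u) = of_int \<gamma> \<longleftrightarrow>
    real (D 0) = (real n - real_of_int \<gamma>) / real p + real_of_int \<gamma> \<and>
    (\<forall>u\<in>{1..<p}. real (D u) = (real n - real_of_int \<gamma>) / real p)"
    (is "?sum \<longleftrightarrow> ?mult")
proof -
  have p0: "p > 0" using p by (rule prime_gt_0_nat)
  define c where "c u = int (D u) - (if u = 0 then \<gamma> else 0)" for u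
  have "(\<Sum>u<p. of_int (c u) * \<zeta> ^ u) = (\<Sum>u<p. of_nat (D u) * \<zeta> ^ u) - of_int \<gamma>"
  proof -
    have "of_int (c u) * \<zeta> ^ u = of_nat (D u) * \<zeta> ^ u - (if u = 0 then of_int \<gamma> else 0)" for u
      by (simp add: c_def left_diff_distrib)
    thus ?thesis using p0 by (simp add: sum_subtractf)
  qed
  hence "?sum \<longleftrightarrow> (\<forall>u<p. c u = c 0)"
    using integer_relation_primitive_root[OF p \<zeta>, of c] by simp
  also have "\<dots> \<longleftrightarrow> (\<forall>u<p. real_of_int (c u) = (real n - \<gamma>) / p)"
  proof
    assume const: "\<forall>u<p. c u = c 0"
    have "int n - \<gamma> = (\<Sum>u<p. c u)"
      using p0 by (simp add: c_def sum_subtractf flip: n)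
    also have "\<dots> = (\<Sum>u<p. c 0)" using const by (intro sum.cong refl) (metis lessThan_iff)
    also have "\<dots> = int p * c 0" by simp
    finally have "real_of_int (int n - \<gamma>) = real_of_int (int p * c 0)" by (rule arg_cong)
    hence "real_of_int (c 0) = (real n - \<gamma>) / p"
      using p0 by (simp add: field_simps)
    thus "\<forall>u<p. real_of_int (c u) = (real n - \<gamma>) / p" using const by metis
  next
    assume "\<forall>u<p. real_of_int (c u) = (real n - \<gamma>) / p"
    thus "\<forall>u<p. c u = c 0" using p0 by (metis of_int_eq_iff)
  qed
  also have "\<dots> \<longleftrightarrow> ?mult"
  proof -
    have "(\<forall>u<p. Q u) \<longleftrightarrow> Q 0 \<and> (\<forall>u\<in>{1..<p}. Q u)" for Q
      using p0 by (auto simp: Suc_le_eq)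
    thus ?thesis by (auto simp: c_def)
  qed
  finally show ?thesis .
qed

section \<open>Correlations as counts of exponent differences\<close>

text \<open>
  Subtraction modulo \<open>n\<close> on natural numbers, with \<open>n - j\<close> in place of \<open>- j\<close>.
\<close>

lemma mod_eq_add_iff:
  fixes i j k n :: nat
  assumes "k < n" and "j \<le> n"
  shows "i mod n = (k + j) mod n \<longleftrightarrow> k = (i + (n - j)) mod n"
proof
  assume "i mod n = (k + j) mod n"
  hence "(i + (n - j)) mod n = (k + j + (n - j)) mod n" by (rule mod_add_cong) simp
  thus "k = (i + (n - j)) mod n" using assms by simp
next
  assume "k = (i + (n - j)) mod n"
  hence "(k + j) mod n = (i + (n - j) + j) mod n" by (simp add: mod_add_left_eq)
  thus "i mod n = (k + j) mod n" using assms by simp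
qed

text \<open>
  The residue of \<open>b i - b (i + t)\<close> modulo \<open>p\<close>, where \<open>b\<close> is read periodically with period \<open>n\<close>;
  the summand \<open>p\<close> keeps the natural subtraction from truncating as long as \<open>b\<close> stays below \<open>p\<close>.
\<close>

definition exponent_difference :: "nat \<Rightarrow> nat \<Rightarrow> (nat \<Rightarrow> nat) \<Rightarrow> nat \<Rightarrow> nat \<Rightarrow> nat" where
  "exponent_difference p n b t i = (b i + (p - b ((i + t) mod n))) mod p"

definition shift_count :: "nat \<Rightarrow> nat \<Rightarrow> (nat \<Rightarrow> nat) \<Rightarrow> nat \<Rightarrow> nat \<Rightarrow> nat" where
  "shift_count p n b t u = card {i \<in> {..<n}. exponent_difference p n b t i = u}"

lemma sum_by_fibres:
  fixes \<phi> :: "nat \<Rightarrow> 'a::comm_semiring_1"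
  assumes "finite A" and "v ` A \<subseteq> {..<p}"
  shows "(\<Sum>i\<in>A. \<phi> (v i)) = (\<Sum>u<p. of_nat (card {i \<in> A. v i = u}) * \<phi> u)"
  by (subst sum.group[OF assms(1) finite_lessThan assms(2), symmetric]) simp

lemma sum_shift_count:
  assumes "p > 0"
  shows "(\<Sum>u<p. shift_count p n b t u) = n"
proof -
  have "exponent_difference p n b t ` {..<n} \<subseteq> {..<p}"
    using assms by (auto simp: exponent_difference_def)
  thus ?thesis
    using sum_by_fibres[of "{..<n}" "exponent_difference p n b t" p "\<lambda>_. 1::nat"]
    by (simp add: shift_count_def)
qed

lemma cnj_power_root_of_unity:
  assumes "z ^ p = 1" and "k \<le> p" and "p > 0"
  shows "cnj (z ^ k) = z ^ (p - k)"
proof -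
  have "norm z ^ p = 1" using assms(1) by (metis norm_one norm_power)
  hence "norm z = 1" using assms(3) power_eq_imp_eq_base[of "norm z" p 1] by simp
  hence "z ^ k * cnj (z ^ k) = 1" by (metis complex_norm_square norm_power of_real_1 power_one)
  moreover have "z ^ k * z ^ (p - k) = 1" using assms by (simp flip: power_add)
  ultimately have "z ^ k * cnj (z ^ k) = z ^ k * z ^ (p - k)" by (simp only:)
  thus ?thesis using \<open>norm z = 1\<close> by (subst (asm) mult_left_cancel) auto
qed

lemma autocorrelation_eq_sum_shift_count:
  assumes \<zeta>: "\<zeta> ^ p = 1" and "p > 0" and "n > 0" and per: "\<And>i. a (i + n) = a i"
    and b: "\<And>i. i < n \<Longrightarrow> b i < p" and a: "\<And>i. i < n \<Longrightarrow> a i = \<zeta> ^ b i"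
  shows "autocorrelation n a t = (\<Sum>u<p. of_nat (shift_count p n b t u) * \<zeta> ^ u)"
proof -
  have per': "a (i + k * n) = a i" for i k
    proof (induction k)
    case (Suc k)
    have "a (i + Suc k * n) = a (i + k * n + n)" by (simp add: algebra_simps)
    thus ?case using per Suc by simp
  qed simp
  have "a (i mod n) = a i" for i
    using per'[of "i mod n" "i div n"] by (simp add: mod_div_mult_eq)
  hence ap: "a i = \<zeta> ^ b (i mod n)" for i
    using a[of "i mod n"] \<open>n > 0\<close> by simp
  have zmod: "\<zeta> ^ (m mod p) = \<zeta> ^ m" for m
  proof -
    have "\<zeta> ^ m = \<zeta> ^ (p * (m div p) + m mod p)" by simp
    also have "\<dots> = \<zeta> ^ (m mod p)" by (simp only: power_add power_mult \<zeta> power_one mult_1_left)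
    finally show ?thesis by simp
  qed
  have "a i * cnj (a (i + t)) = \<zeta> ^ exponent_difference p n b t i" if "i < n" for i
  proof -
    have "cnj (a (i + t)) = \<zeta> ^ (p - b ((i + t) mod n))"
      unfolding ap[of "i + t"] using b[of "(i + t) mod n"] assms
      by (intro cnj_power_root_of_unity) (auto intro!: less_imp_le)
    thus ?thesis
      using that by (simp add: a exponent_difference_def zmod power_add)
  qed
  hence "autocorrelation n a t = (\<Sum>i<n. \<zeta> ^ exponent_difference p n b t i)"
    by (simp add: autocorrelation_def)
  also have "\<dots> = (\<Sum>u<p. of_nat (shift_count p n b t u) * \<zeta> ^ u)"
    unfolding shift_count_def
    by (rule sum_by_fibres) (use \<open>p > 0\<close> in \<open>auto simp: exponent_difference_def\<close>)
  finally show ?thesis .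
qed

section \<open>The same counts as numbers of group differences\<close>

context group
begin

lemma cyclic_pow_eq_iff:
  fixes i j :: nat
  assumes x: "x \<in> carrier G" and gen: "generate G {x} = carrier G"
  shows "x [^] i = x [^] j \<longleftrightarrow> i mod order G = j mod order G"
proof -
  have "ord x = order G"
    using generate_pow_card[OF x] gen by (simp add: order_def)
  have "x [^] i = x [^] j \<longleftrightarrow> int (order G) dvd int j - int i"
    using int_pow_eq[OF x, of "int i" "int j"] \<open>ord x = order G\<close> by (simp add: int_pow_int)
  also have "\<dots> \<longleftrightarrow> int j mod int (order G) = int i mod int (order G)"
    by (rule mod_eq_dvd_iff[symmetric])
  also have "\<dots> \<longleftrightarrow> i mod order G = j mod order G"
    by (auto simp flip: zmod_int)
  finally show ?thesis .
qed

lemma cyclic_carrier: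
  assumes x: "x \<in> carrier G" and gen: "generate G {x} = carrier G" and "order G > 0"
  shows "carrier G = (\<lambda>k::nat. x [^] k) ` {..<order G}"
proof
  have fin: "finite (carrier G)" using \<open>order G > 0\<close> by (simp add: order_gt_0_iff_finite)
  show "carrier G \<subseteq> (\<lambda>k::nat. x [^] k) ` {..<order G}"
  proof
    fix y assume "y \<in> carrier G"
    hence "y \<in> {x [^] k | k. k \<in> (UNIV :: nat set)}"
      using generate_pow_on_finite_carrier[OF fin x] gen by simp
    then obtain k :: nat where "y = x [^] k" by blast
    also have "\<dots> = x [^] (k mod order G)"
      by (simp add: cyclic_pow_eq_iff[OF x gen])
    finally show "y \<in> (\<lambda>k::nat. x [^] k) ` {..<order G}"
      using \<open>order G > 0\<close> by (intro image_eqI[of _ _ "k mod order G"]) simp_all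
  qed
qed (use x in auto)

lemma cyclic_nonidentity:
  assumes x: "x \<in> carrier G" and gen: "generate G {x} = carrier G" and pos: "order G > 0"
  shows "carrier G - {\<one>} = (\<lambda>k::nat. x [^] k) ` {1..<order G}"
proof -
  have inj: "inj_on (\<lambda>k::nat. x [^] k) {..<order G}"
    by (rule inj_onI) (simp add: cyclic_pow_eq_iff[OF x gen])
  have "{1..<order G} = {..<order G} - {0}" by auto
  hence "(\<lambda>k::nat. x [^] k) ` {1..<order G}
      = (\<lambda>k::nat. x [^] k) ` {..<order G} - (\<lambda>k::nat. x [^] k) ` {0}"
    using inj_on_image_set_diff[OF inj, of "{..<order G}" "{0}"] pos by simp
  thus ?thesis using cyclic_carrier[OF assms] by simp
qed

lemma cyclic_quotient_eq_iff:
  fixes i j k :: nat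
  assumes x: "x \<in> carrier G" and gen: "generate G {x} = carrier G"
  shows "x [^] i \<otimes> inv (x [^] j) = x [^] k \<longleftrightarrow> i mod order G = (k + j) mod order G"
proof -
  have "x [^] i \<otimes> inv (x [^] j) = x [^] k \<longleftrightarrow> x [^] i = x [^] k \<otimes> x [^] j"
    using x inv_solve_right'[of "x [^] k" "x [^] i" "x [^] j"] by auto
  also have "\<dots> \<longleftrightarrow> i mod order G = (k + j) mod order G"
    using x by (simp add: nat_pow_mult cyclic_pow_eq_iff[OF x gen])
  finally show ?thesis .
qed

end

lemma DirProd_nat_pow:
  "(x, y) [^]\<^bsub>H \<times>\<times> P\<^esub> (k::nat) = (x [^]\<^bsub>H\<^esub> k, y [^]\<^bsub>P\<^esub> k)"
  by (induction k) simp_all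

text \<open>
  The set \<open>R\<close> is the graph of the map from \<open>H\<close> to \<open>P\<close> that sends the \<open>i\<close>-th power of \<open>h\<close> to
  the \<open>b i\<close>-th power of \<open>g\<close>. Counting its differences is a
  matter of exponents in two finite cyclic groups.
\<close>

locale cyclic_graph =
  H: group H + P: group P
  for H :: "('a, 'c) monoid_scheme" and P :: "('b, 'd) monoid_scheme" +
  fixes h :: 'a and g :: 'b and n p :: nat and b :: "nat \<Rightarrow> nat"
  assumes h: "h \<in> carrier H" "generate H {h} = carrier H" "order H = n"
    and g: "g \<in> carrier P" "generate P {g} = carrier P" "order P = p"
    and n_pos: "0 < n" and p_pos: "0 < p" and b_less: "\<And>i. i < n \<Longrightarrow> b i < p"
begin

definition point :: "nat \<Rightarrow> 'a \<times> 'b" where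
  "point i = (h [^]\<^bsub>H\<^esub> i, g [^]\<^bsub>P\<^esub> b i)"

abbreviation graph :: "('a \<times> 'b) set" where
  "graph \<equiv> point ` {..<n}"

lemma h_pow_eq_iff: "h [^]\<^bsub>H\<^esub> (i::nat) = h [^]\<^bsub>H\<^esub> (j::nat) \<longleftrightarrow> i mod n = j mod n"
  using H.cyclic_pow_eq_iff[OF h(1,2)] h(3) by simp

lemma inj_on_point: "inj_on point {..<n}"
  by (rule inj_onI) (simp add: point_def h_pow_eq_iff)

lemma graph_subset: "graph \<subseteq> carrier (H \<times>\<times> P)"
  using h g by (auto simp: point_def)

lemma card_graph: "card graph = n"
  by (simp add: card_image inj_on_point)

lemma quotient_points:
  "point i \<otimes>\<^bsub>H \<times>\<times> P\<^esub> inv\<^bsub>H \<times>\<times> P\<^esub> point j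
     = (h [^]\<^bsub>H\<^esub> i \<otimes>\<^bsub>H\<^esub> inv\<^bsub>H\<^esub> (h [^]\<^bsub>H\<^esub> j), g [^]\<^bsub>P\<^esub> b i \<otimes>\<^bsub>P\<^esub> inv\<^bsub>P\<^esub> (g [^]\<^bsub>P\<^esub> b j))"
  using h g by (simp add: point_def inv_DirProd[OF H.group_axioms P.group_axioms])

text \<open>
  The first coordinate is written as the power \<open>n - t\<close>, not \<open>t\<close>, because the autocorrelation
  conjugates the later term: its difference of positions is \<open>i - (i + t)\<close>.
\<close>

lemma quotient_points_eq_iff:
  assumes "i < n" "j < n" "0 < t" "t < n" "u < p"
  shows "point i \<otimes>\<^bsub>H \<times>\<times> P\<^esub> inv\<^bsub>H \<times>\<times> P\<^esub> point j = (h [^]\<^bsub>H\<^esub> (n - t), g [^]\<^bsub>P\<^esub> u)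
    \<longleftrightarrow> j = (i + t) mod n \<and> exponent_difference p n b t i = u"
proof -
  have "h [^]\<^bsub>H\<^esub> i \<otimes>\<^bsub>H\<^esub> inv\<^bsub>H\<^esub> (h [^]\<^bsub>H\<^esub> j) = h [^]\<^bsub>H\<^esub> (n - t) \<longleftrightarrow> i mod n = (j + (n - t)) mod n"
    using H.cyclic_quotient_eq_iff[OF h(1,2)] h(3) by (simp add: add.commute)
  also have "\<dots> \<longleftrightarrow> j = (i + t) mod n"
    using mod_eq_add_iff[of j n "n - t" i] assms by simp
  finally have H_part: "h [^]\<^bsub>H\<^esub> i \<otimes>\<^bsub>H\<^esub> inv\<^bsub>H\<^esub> (h [^]\<^bsub>H\<^esub> j) = h [^]\<^bsub>H\<^esub> (n - t) \<longleftrightarrow> j = (i + t) mod n" .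
  have "g [^]\<^bsub>P\<^esub> b i \<otimes>\<^bsub>P\<^esub> inv\<^bsub>P\<^esub> (g [^]\<^bsub>P\<^esub> b j) = g [^]\<^bsub>P\<^esub> u \<longleftrightarrow> b i mod p = (u + b j) mod p"
    using P.cyclic_quotient_eq_iff[OF g(1,2)] g(3) by simp
  also have "\<dots> \<longleftrightarrow> (b i + (p - b j)) mod p = u"
    using mod_eq_add_iff[of u p "b j" "b i"] b_less[of j] assms by auto
  finally show ?thesis
    using H_part by (auto simp: quotient_points exponent_difference_def)
qed

text \<open>
  The first coordinate of the group element fixes the second position as \<open>i + t\<close> modulo \<open>n\<close>, so the
  pairs of elements that represent it are parametrised by \<open>i\<close> alone. The two elements are
  distinct since \<open>t\<close> is not a multiple of \<open>n\<close>.
\<close>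

lemma difference_count_eq_shift_count:
  assumes t: "0 < t" "t < n" and u: "u < p"
  shows "difference_count (H \<times>\<times> P) graph (h [^]\<^bsub>H\<^esub> (n - t), g [^]\<^bsub>P\<^esub> u) = shift_count p n b t u"
proof -
  let ?A = "{i \<in> {..<n}. exponent_difference p n b t i = u}"
  let ?f = "\<lambda>i. (point i, point ((i + t) mod n))"
  have ne: "point i \<noteq> point ((i + t) mod n)" if "i < n" for i
  proof
    assume "point i = point ((i + t) mod n)"
    hence "i = (i + t) mod n"
      using inj_on_point that n_pos by (simp add: inj_on_def)
    thus False using that t by (cases "i + t < n") (simp_all add: le_mod_geq)
  qed
  have "{(r1, r2). r1 \<in> graph \<and> r2 \<in> graph \<and> r1 \<noteq> r2 \<and>
          r1 \<otimes>\<^bsub>H \<times>\<times> P\<^esub> inv\<^bsub>H \<times>\<times> P\<^esub> r2 = (h [^]\<^bsub>H\<^esub> (n - t), g [^]\<^bsub>P\<^esub> u)} = ?f ` ?A" (is "?S = _")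
  proof
    show "?S \<subseteq> ?f ` ?A"
      using quotient_points_eq_iff[OF _ _ t u] by auto
    show "?f ` ?A \<subseteq> ?S"
      proof (rule image_subsetI)
      fix i assume "i \<in> ?A"
      thus "?f i \<in> ?S"
        using quotient_points_eq_iff[OF _ _ t u, of i "(i + t) mod n"] ne[of i] n_pos by simp
    qed
  qed
  moreover have "inj_on ?f ?A"
    using inj_on_point by (auto simp: inj_on_def)
  ultimately show ?thesis
    by (simp add: difference_count_def shift_count_def card_image)
qed

text \<open>
  A difference with trivial first coordinate comes from two elements above the same power of \<open>h\<close>,
  and a graph has only one.
\<close>

lemma difference_count_right_factor:
  assumes "y \<noteq> \<one>\<^bsub>P\<^esub>"
  shows "difference_count (H \<times>\<times> P) graph (\<one>\<^bsub>H\<^esub>, y) = 0"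
proof -
  have "point i = point j"
    if "i < n" "j < n" "point i \<otimes>\<^bsub>H \<times>\<times> P\<^esub> inv\<^bsub>H \<times>\<times> P\<^esub> point j = (\<one>\<^bsub>H\<^esub>, y)" for i j
  proof -
    have "h [^]\<^bsub>H\<^esub> i \<otimes>\<^bsub>H\<^esub> inv\<^bsub>H\<^esub> (h [^]\<^bsub>H\<^esub> j) = h [^]\<^bsub>H\<^esub> (0::nat)"
      using that by (simp add: quotient_points)
    hence "i mod n = j mod n"
      using H.cyclic_quotient_eq_iff[OF h(1,2)] h(3) by (metis add_0)
    thus ?thesis using that by simp
  qed
  hence "{(r1, r2). r1 \<in> graph \<and> r2 \<in> graph \<and> r1 \<noteq> r2 \<and>
          r1 \<otimes>\<^bsub>H \<times>\<times> P\<^esub> inv\<^bsub>H \<times>\<times> P\<^esub> r2 = (\<one>\<^bsub>H\<^esub>, y)} = {}"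
    by blast
  thus ?thesis unfolding difference_count_def by (simp only: card.empty)
qed

lemma nonidentity_powers_H:
  "carrier H - {\<one>\<^bsub>H\<^esub>} = (\<lambda>t. h [^]\<^bsub>H\<^esub> (n - t)) ` {1..n - 1}"
proof -
  have "{1..<n} = (\<lambda>t. n - t) ` {1..n - 1}"
  proof
    show "{1..<n} \<subseteq> (\<lambda>t. n - t) ` {1..n - 1}"
      by (rule subsetI, rule_tac x = "n - x" in image_eqI) auto
  qed auto
  hence "(\<lambda>s. h [^]\<^bsub>H\<^esub> s) ` {1..<n} = (\<lambda>s. h [^]\<^bsub>H\<^esub> s) ` (\<lambda>t. n - t) ` {1..n - 1}"
    by (rule arg_cong)
  thus ?thesis
    using H.cyclic_nonidentity[OF h(1,2)] h(3) n_pos by (simp add: image_image)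
qed

lemma nonidentity_powers_P:
  "carrier P - {\<one>\<^bsub>P\<^esub>} = (\<lambda>u. g [^]\<^bsub>P\<^esub> u) ` {1..<p}"
  using P.cyclic_nonidentity[OF g(1,2)] g(3) p_pos by simp

text \<open>
  As \<open>t\<close> runs through \<open>1, \<dots>, n - 1\<close> and \<open>u\<close> through \<open>0, \<dots>, p - 1\<close>, the elements with
  exponents \<open>n - t\<close> and \<open>u\<close> run through the complement of the second factor, and those with
  \<open>u = 0\<close> through the non-identity part of the first.
\<close>

lemma direct_product_difference_set_iff:
  "direct_product_difference_set H P n p n l1 0 mu graph \<longleftrightarrow>
     (\<forall>t\<in>{1..n - 1}. real (shift_count p n b t 0) = l1 \<and>
        (\<forall>u\<in>{1..<p}. real (shift_count p n b t u) = mu))"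
proof -
  have left: "left_factor H P - {\<one>\<^bsub>H \<times>\<times> P\<^esub>}
      = (\<lambda>t. (h [^]\<^bsub>H\<^esub> (n - t), g [^]\<^bsub>P\<^esub> (0::nat))) ` {1..n - 1}"
  proof -
    have "left_factor H P - {\<one>\<^bsub>H \<times>\<times> P\<^esub>} = (\<lambda>x. (x, \<one>\<^bsub>P\<^esub>)) ` (carrier H - {\<one>\<^bsub>H\<^esub>})"
      by (auto simp: left_factor_def)
    thus ?thesis by (simp add: nonidentity_powers_H image_image)
  qed
  have rest: "carrier (H \<times>\<times> P) - (left_factor H P \<union> right_factor H P)
      = (\<lambda>(t, u). (h [^]\<^bsub>H\<^esub> (n - t), g [^]\<^bsub>P\<^esub> u)) ` ({1..n - 1} \<times> {1..<p})"
  proof -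
    have "carrier (H \<times>\<times> P) - (left_factor H P \<union> right_factor H P)
        = (carrier H - {\<one>\<^bsub>H\<^esub>}) \<times> (carrier P - {\<one>\<^bsub>P\<^esub>})"
      by (auto simp: left_factor_def right_factor_def)
    also have "\<dots> = (\<lambda>(t, u). (h [^]\<^bsub>H\<^esub> (n - t), g [^]\<^bsub>P\<^esub> u)) ` ({1..n - 1} \<times> {1..<p})"
      unfolding nonidentity_powers_H nonidentity_powers_P by fast
    finally show ?thesis .
  qed
  have right: "difference_count (H \<times>\<times> P) graph x = 0"
    if "x \<in> right_factor H P - {\<one>\<^bsub>H \<times>\<times> P\<^esub>}" for x
  proof -
    from that obtain y where x: "x = (\<one>\<^bsub>H\<^esub>, y)" and y: "y \<noteq> \<one>\<^bsub>P\<^esub>"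
      by (auto simp: right_factor_def)
    show ?thesis unfolding x using y by (rule difference_count_right_factor)
  qed
  have fin: "finite (carrier H)" "finite (carrier P)"
    using h(3) g(3) n_pos p_pos H.order_gt_0_iff_finite P.order_gt_0_iff_finite by metis+
  have count: "difference_count (H \<times>\<times> P) graph (h [^]\<^bsub>H\<^esub> (n - t), g [^]\<^bsub>P\<^esub> u) = shift_count p n b t u"
    if "t \<in> {1..n - 1}" "u < p" for t u
    using that n_pos by (intro difference_count_eq_shift_count) auto
  have count0: "difference_count (H \<times>\<times> P) graph (h [^]\<^bsub>H\<^esub> (n - t), \<one>\<^bsub>P\<^esub>) = shift_count p n b t 0"
    if "t \<in> {1..n - 1}" for t
    using count[OF that p_pos] by simp
  have right_all: "\<forall>x \<in> right_factor H P - {\<one>\<^bsub>H \<times>\<times> P\<^esub>}. real (difference_count (H \<times>\<times> P) graph x) = 0"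
    using right by (metis of_nat_0)
  have "direct_product_difference_set H P n p n l1 0 mu graph \<longleftrightarrow>
      (\<forall>x \<in> left_factor H P - {\<one>\<^bsub>H \<times>\<times> P\<^esub>}. real (difference_count (H \<times>\<times> P) graph x) = l1) \<and>
      (\<forall>x \<in> carrier (H \<times>\<times> P) - (left_factor H P \<union> right_factor H P).
         real (difference_count (H \<times>\<times> P) graph x) = mu)"
    unfolding direct_product_difference_set_def
    using graph_subset card_graph fin h(3) g(3) right_all H.group_axioms P.group_axioms by blast
  also have "\<dots> \<longleftrightarrow> (\<forall>t\<in>{1..n - 1}. real (shift_count p n b t 0) = l1) \<and>
      (\<forall>t\<in>{1..n - 1}. \<forall>u\<in>{1..<p}. real (shift_count p n b t u) = mu)"
    unfolding left rest by (auto simp: count count0)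
  finally show ?thesis by blast
qed

end

theorem theorem1:
  fixes p n :: nat and \<gamma> :: int and a :: "nat \<Rightarrow> complex" and b :: "nat \<Rightarrow> nat"
    and \<zeta> :: complex
    and H :: "('a, 'c) monoid_scheme" and P :: "('b, 'd) monoid_scheme"
    and h :: 'a and g :: 'b and R :: "('a \<times> 'b) set"
  assumes "prime p" and "n \<ge> 2"
    and "p_ary_sequence p n a"
    and "group H" and "h \<in> carrier H" and "generate H {h} = carrier H" and "order H = n"
    and "group P" and "g \<in> carrier P" and "generate P {g} = carrier P" and "order P = p"
    and "primitive_root_of_unity p \<zeta>"
    and "\<And>i. i < n \<Longrightarrow> b i \<in> {0..p - 1} \<and> a i = \<zeta> ^ b i"
    and "R = {(\<one>\<^bsub>H\<^esub>, g) [^]\<^bsub>H \<times>\<times> P\<^esub> b i \<otimes>\<^bsub>H \<times>\<times> P\<^esub> (h, \<one>\<^bsub>P\<^esub>) [^]\<^bsub>H \<times>\<times> P\<^esub> i | i. i < n}"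
  shows "(nearly_perfect_sequence p n (of_int \<gamma>) a \<longleftrightarrow>
           direct_product_difference_set H P n p n
             ((real n - real_of_int \<gamma>) / real p + real_of_int \<gamma>) 0
             ((real n - real_of_int \<gamma>) / real p) R)
         \<and> (nearly_perfect_sequence p n (of_int \<gamma>) a \<longrightarrow> int p dvd int n - \<gamma>)"
proof -
  have p0: "p > 0" using \<open>prime p\<close> by (rule prime_gt_0_nat)
  have b: "b i < p" if "i < n" for i using assms(13)[OF that] p0 by auto
  interpret cyclic_graph H P h g n p b
    by (intro cyclic_graph.intro cyclic_graph_axioms.intro) (use assms p0 b in auto)
  have "(\<one>\<^bsub>H\<^esub>, g) [^]\<^bsub>H \<times>\<times> P\<^esub> b i \<otimes>\<^bsub>H \<times>\<times> P\<^esub> (h, \<one>\<^bsub>P\<^esub>) [^]\<^bsub>H \<times>\<times> P\<^esub> i = point i" for i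
    using h g by (simp add: DirProd_nat_pow point_def)
  hence R: "R = graph" unfolding assms(14) by auto
  have ac: "autocorrelation n a t = (\<Sum>u<p. of_nat (shift_count p n b t u) * \<zeta> ^ u)" for t
    using assms p0 b n_pos
    by (intro autocorrelation_eq_sum_shift_count)
       (auto simp: p_ary_sequence_def primitive_root_of_unity_def)
  have perfect_iff: "nearly_perfect_sequence p n (of_int \<gamma>) a \<longleftrightarrow>
      (\<forall>t\<in>{1..n - 1}.
         real (shift_count p n b t 0) = (real n - real_of_int \<gamma>) / real p + real_of_int \<gamma> \<and>
         (\<forall>u\<in>{1..<p}. real (shift_count p n b t u) = (real n - real_of_int \<gamma>) / real p))"
    unfolding nearly_perfect_sequence_def ac
      weighted_root_sum_eq_int_iff[OF assms(1,12) sum_shift_count[OF p0]]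
    using assms(3) by simp
  have "int p dvd int n - \<gamma>" if "nearly_perfect_sequence p n (of_int \<gamma>) a"
  proof -
    have "real (shift_count p n b 1 1) = (real n - real_of_int \<gamma>) / real p"
      using that \<open>n \<ge> 2\<close> prime_gt_1_nat[OF \<open>prime p\<close>] unfolding perfect_iff by simp
    hence "real_of_int (int n - \<gamma>) = real_of_int (int p * int (shift_count p n b 1 1))"
      using p0 by (simp add: field_simps)
    hence "int n - \<gamma> = int p * int (shift_count p n b 1 1)"
      by (simp only: of_int_eq_iff)
    thus ?thesis by simp
  qed
  thus ?thesis
    unfolding R direct_product_difference_set_iff perfect_iff by blast
qed

end
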